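(* Let $e,k,n$ be integers with $1\le k\le e-3$, $n\ge2$ and $$\frac{n-2}{n-1}<\frac{k}{e-1}\le\frac{n-1}{n},$$ and let $S=\langle e,e+k+1,e+k+2,\ldots,2e-1\rangle$. Then the Frobenius number $F$ and the genus $G$ of $S$ are $$F=ne+(n-1)k+(n-2),\qquad G=n(n-1)k-(n^2-3n+1)(e-1).$$ Further, $S$ is symmetric if and only if $(n-1)k=(n-2)e-(n-3)$.
   Context: The Frobenius number of a numerical semigroup is its largest gap (nonnegative integer not in it) and the genus is its number of gaps. A numerical semigroup is symmetric iff $2G=F+1$. *)

theory Defs
  imports Complex_Main
begin

inductive_set semigroup_generated :: "nat set \<Rightarrow> nat set" for A :: "nat set" where
  zero: "0 \<in> semigroup_generated A"
| add: "a \<in> A \<Longrightarrow> x \<in> semigroup_generated A \<Longrightarrow> a + x \<in> semigroup_generated A"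

definition gaps :: "nat set \<Rightarrow> nat set" where
  "gaps S = - S"

definition numerical_semigroup :: "nat set \<Rightarrow> bool" where
  "numerical_semigroup S \<longleftrightarrow>
     0 \<in> S \<and> (\<forall>x\<in>S. \<forall>y\<in>S. x + y \<in> S) \<and> finite (gaps S)"

text \<open>The following two are only meaningful if the set of gaps is finite and, for the
  Frobenius number, nonempty.\<close>

definition frobenius_number :: "nat set \<Rightarrow> nat" where
  "frobenius_number S = Max (gaps S)"

definition genus :: "nat set \<Rightarrow> nat" where
  "genus S = card (gaps S)"

text \<open>Symmetry is the reflection property of \<open>S\<close> inside the integers: exactly one of \<open>x\<close> and
  \<open>F - x\<close> lies in \<open>S\<close>. The lemma \<open>symmetric_iff_genus\<close> below shows that this is the
  same as \<open>2 G = F + 1\<close>.\<close>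

definition symmetric_semigroup :: "nat set \<Rightarrow> bool" where
  "symmetric_semigroup S \<longleftrightarrow>
     (\<forall>x::int. x \<in> int ` S \<longleftrightarrow> int (frobenius_number S) - x \<notin> int ` S)"

lemma symmetric_iff_genus:
  assumes S: "numerical_semigroup S" and ne: "S \<noteq> UNIV"
  shows "symmetric_semigroup S \<longleftrightarrow> 2 * genus S = frobenius_number S + 1"
proof -
  define F where "F = frobenius_number S"
  have fin: "finite (gaps S)" and clos: "\<And>x y. x \<in> S \<Longrightarrow> y \<in> S \<Longrightarrow> x + y \<in> S"
    using S by (auto simp: numerical_semigroup_def)
  have gne: "gaps S \<noteq> {}" using ne by (auto simp: gaps_def)
  have FS: "F \<notin> S"
    using Max_in[OF fin gne] by (simp add: F_def frobenius_number_def gaps_def)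
  have big: "x \<in> S" if "x > F" for x
  proof (rule ccontr)
    assume "x \<notin> S"
    then have "x \<in> gaps S" by (simp add: gaps_def)
    then have "x \<le> F" using Max_ge[OF fin] by (simp add: F_def frobenius_number_def)
    then show False using that by simp
  qed
  define L where "L = S \<inter> {..F}"
  define R where "R = (\<lambda>x. F - x) ` L"
  have gapsle: "gaps S \<subseteq> {..F}" 
  proof
    fix x assume "x \<in> gaps S"
    then show "x \<in> {..F}" using big[of x] by (cases "x \<le> F") (auto simp: gaps_def)
  qed
  have "card L + card (gaps S) = card (L \<union> gaps S)"
    using fin by (subst card_Un_disjoint) (auto simp: L_def gaps_def)
  also have "L \<union> gaps S = {..F}" using gapsle by (auto simp: L_def gaps_def)
  finally have tot: "card L + genus S = F + 1" by (simp add: genus_def)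
  have "inj_on (\<lambda>x. F - x) L" by (auto simp: inj_on_def L_def)
  then have cR: "card R = card L" by (simp add: R_def card_image)
  have sub: "R \<subseteq> gaps S"
  proof
    fix y assume "y \<in> R"
    then obtain x where x: "x \<in> S" "x \<le> F" "y = F - x" by (auto simp: R_def L_def)
    then show "y \<in> gaps S" using clos[of x y] FS by (auto simp: gaps_def)
  qed
  have "2 * genus S = F + 1 \<longleftrightarrow> card R = card (gaps S)"
    using tot cR by (auto simp: genus_def)
  also have "\<dots> \<longleftrightarrow> R = gaps S"
    using sub fin card_subset_eq by blast
  also have "\<dots> \<longleftrightarrow> symmetric_semigroup S"
  proof
    assume RG: "R = gaps S"
    have "x \<in> int ` S \<longleftrightarrow> int F - x \<notin> int ` S" for x
    proof -
      consider "x < 0" | "x > int F" | m where "x = int m" "m \<le> F"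
      proof (cases "x < 0 \<or> x > int F")
        case False
        then have "x = int (nat x)" "nat x \<le> F" by auto
        then show ?thesis using that(3) by blast
      qed (use that in blast)
      then show ?thesis
      proof cases
        case 1
        then have "int F - x = int (nat (int F - x))" "nat (int F - x) > F" by auto
        then have "int F - x \<in> int ` S" using big by (metis imageI)
        then show ?thesis using 1 by auto
      next
        case 2
        then have "x = int (nat x)" "nat x > F" by auto
        then have "x \<in> int ` S" using big by (metis imageI)
        then show ?thesis using 2 by auto
      next
        case 3
        have Fx: "int F - x = int (F - m)" using 3 by simp
        have emb: "int z \<in> int ` S \<longleftrightarrow> z \<in> S" for z by auto
        have eq: "x \<in> int ` S \<longleftrightarrow> m \<in> S" "int F - x \<in> int ` S \<longleftrightarrow> F - m \<in> S"
          unfolding Fx emb by (simp_all only: 3(1) emb)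
        have "m \<in> S \<Longrightarrow> F - m \<notin> S" using clos[of m "F - m"] FS 3 by auto
        moreover have "m \<in> S" if "F - m \<notin> S"
        proof -
          have "F - m \<in> R" using that RG by (simp add: gaps_def)
          then obtain z where "z \<in> S" "z \<le> F" "F - m = F - z" by (auto simp: R_def L_def)
          then have "m = z" using 3(2) by linarith
          then show ?thesis using \<open>z \<in> S\<close> by simp
        qed
        ultimately show ?thesis using eq by blast
      qed
    qed
    then show "symmetric_semigroup S" 
      unfolding symmetric_semigroup_def F_def by (rule allI)
  next
    assume sym: "symmetric_semigroup S"
    have "gaps S \<subseteq> R"
    proof
      fix y assume y: "y \<in> gaps S"
      then have "y \<le> F" "int y \<notin> int ` S" using gapsle by (auto simp: gaps_def)
      then have "int F - int y \<in> int ` S"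
        using sym[unfolded symmetric_semigroup_def, rule_format, of "int y"]
        unfolding F_def by blast
      then have "int (F - y) \<in> int ` S" using \<open>y \<le> F\<close> by (simp add: of_nat_diff)
      then have "F - y \<in> S" by auto
      then show "y \<in> R" using \<open>y \<le> F\<close> by (force simp: R_def L_def)
    qed
    then show "R = gaps S" using sub by blast
  qed
  finally show ?thesis by (simp add: F_def)
qed

end

theory Submission
  imports Defs
begin

text \<open>
  Put \<open>d = e - 1 - k\<close>, so that \<open>S\<close> is generated by \<open>e\<close> and the \<open>d\<close> consecutive numbers
  \<open>2 e - d, \<dots>, 2 e - 1\<close>. A sum of \<open>j\<close> generators, \<open>i\<close> of them different from \<open>e\<close>, ranges
  over the whole interval \<open>[j e + i (e - d), j e + i (e - 1)]\<close>, and \<open>S\<close> is the union of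
  these intervals over \<open>i \<le> j\<close> (\<open>semigroup_generated_interval_iff\<close>). Write
  \<open>v = e - 1 - r\<close> for the distance of a nonzero residue \<open>r\<close> modulo \<open>e\<close> from \<open>e - 1\<close>. The
  cheapest way to reach this residue uses the least \<open>i\<close> with \<open>v + 1 \<le> i d\<close> and no further
  generator \<open>e\<close>, that is \<open>i = j = v div d + 1\<close>, and the element reached is
  \<open>(2 (v div d) + 1) e + r\<close>. Hence the gaps of residue \<open>r\<close> are the numbers \<open>q e + r\<close>
  with \<open>q \<le> 2 (v div d)\<close> (\<open>gaps_eq_staircase\<close>).

  The two fractional inequalities say \<open>(n - 1) d < e - 1 \<le> n d\<close>, or
  \<open>e - 1 = (n - 1) d + s\<close> with \<open>1 \<le> s \<le> d\<close>. As \<open>v\<close> runs through \<open>0, \<dots>, e - 2\<close>, the step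
  \<open>v div d\<close> takes each of the values \<open>0, \<dots>, n - 2\<close> exactly \<open>d\<close> times and the value \<open>n - 1\<close>
  exactly \<open>s\<close> times. The largest gap lies at the beginning of the last step, the genus is the
  sum of the odd numbers \<open>2 (v div d) + 1\<close>, and
  \<open>2 G - (F + 1) = (2 n - 1) (s - 1)\<close>, so that symmetry means \<open>s = 1\<close>.
\<close>

section \<open>Generation by a number and an interval\<close>

lemma semigroup_generated_add_closed:
  assumes "x \<in> semigroup_generated A" "y \<in> semigroup_generated A"
  shows "x + y \<in> semigroup_generated A"
  using assms
  by (induction x) (auto simp: add.assoc intro: semigroup_generated.add)

text \<open>A generator that differs from \<open>e\<close> counts as \<open>e\<close> plus an excess in \<open>[a, b]\<close>, and the
  \<open>i\<close>-fold sumset of an interval is the interval with \<open>i\<close>-fold endpoints.\<close>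

lemma semigroup_generated_interval_iff:
  fixes e a b x :: nat
  assumes "a \<le> b"
  shows "x \<in> semigroup_generated ({e} \<union> {e + a..e + b}) \<longleftrightarrow>
    (\<exists>i j. i \<le> j \<and> j * e + i * a \<le> x \<and> x \<le> j * e + i * b)"
    (is "x \<in> ?S \<longleftrightarrow> ?P x")
proof
  assume "x \<in> ?S"
  then show "?P x"
  proof induction
    case zero
    show ?case by (rule exI[of _ 0], rule exI[of _ 0]) simp
  next
    case (add g x)
    then obtain i j where ij: "i \<le> j" "j * e + i * a \<le> x" "x \<le> j * e + i * b" by blast
    from add(1) consider "g = e" | "e + a \<le> g" "g \<le> e + b" by auto
    then show ?case
    proof cases
      case 1
      then show ?thesis using ij by (intro exI[of _ i] exI[of _ "Suc j"]) auto
    next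
      case 2
      then show ?thesis using ij by (intro exI[of _ "Suc i"] exI[of _ "Suc j"]) auto
    qed
  qed
next
  have "x \<in> ?S" if "i \<le> j" "j * e + i * a \<le> x" "x \<le> j * e + i * b" for i j
    using that
  proof (induction j arbitrary: i x)
    case 0
    then show ?case by (simp add: semigroup_generated.zero)
  next
    case (Suc j)
    show ?case
    proof (cases "i \<le> j")
      case True
      have "x - e \<in> ?S"
        using Suc.prems by (intro Suc.IH[OF True]) auto
      then have "e + (x - e) \<in> ?S" by (intro semigroup_generated.add) auto
      then show ?thesis using Suc.prems by simp
    next
      case False
      then have i: "i = Suc j" using Suc.prems by simp
      \<comment> \<open>The least admissible generator that leaves a remainder below the upper end of
        the interval for \<open>j\<close> summands.\<close>
      define g where "g = max (e + a) (x - (j * e + j * b))"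
      have ab: "j * a \<le> j * b" using assms by simp
      have g: "e + a \<le> g" "g \<le> e + b" "g + (j * e + j * a) \<le> x" "x - g \<le> j * e + j * b"
        using Suc.prems assms ab unfolding g_def i mult_Suc by linarith+
      have "x - g \<in> ?S" using g by (intro Suc.IH[of j]) auto
      then have "g + (x - g) \<in> ?S" using g by (intro semigroup_generated.add) auto
      then show ?thesis using g by simp
    qed
  qed
  then show "?P x \<Longrightarrow> x \<in> ?S" by blast
qed

section \<open>The staircase of gaps\<close>

text \<open>The index \<open>v\<close> stands for the residue \<open>e - 1 - v\<close>: counted from the top residue
  downwards, the number of gaps is a step function with steps of length \<open>d\<close>.\<close>

definition staircase :: "nat \<Rightarrow> nat \<Rightarrow> nat set" where
  "staircase e d = (\<lambda>(v, q). q * e + (e - 1 - v)) ` (SIGMA v:{..<e - 1}. {..2 * (v div d)})"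

text \<open>If \<open>q e + e - 1 - v\<close> is in the interval given by \<open>i \<le> j\<close>, then \<open>j + i = q + 1 + t\<close> for
  some \<open>t \<ge> 0\<close>, and the lower end forces \<open>v + 1 + t e \<le> i d\<close>. As \<open>d \<le> e\<close>, this gives
  \<open>i \<ge> v div d + t + 1\<close>, so wrapping around the residues more often (\<open>t > 0\<close>) never lowers
  \<open>q \<ge> 2 i - 1 - t\<close>.\<close>

lemma interval_misses_staircase:
  fixes e d v q i j :: nat
  assumes d: "0 < d" "d < e" and v: "v < e - 1" and q: "q \<le> 2 * (v div d)" and ij: "i \<le> j"
    and lo: "j * e + i * (e - d) \<le> q * e + (e - 1 - v)"
    and up: "q * e + (e - 1 - v) \<le> j * e + i * (e - 1)"
  shows False
proof -
  have "q * e < (j + i) * e"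
  proof -
    have "i * (e - 1) \<le> i * e" by simp
    then show ?thesis using up v by (simp add: algebra_simps)
  qed
  then have "q < j + i" using d by simp
  then obtain t where t: "j + i = q + 1 + t"
    by (metis add.assoc less_iff_Suc_add Suc_eq_plus1 add.commute)
  have id: "i * (e - d) + i * d = i * e" using d by (simp flip: distrib_left)
  have "(j + i) * e = (q + 1 + t) * e" using t by simp
  then have je: "j * e + i * e = q * e + e + t * e" by (simp add: algebra_simps)
  have key: "v + 1 + t * e \<le> i * d"
    using lo id je v by linarith
  have "t * d \<le> t * e" using d by simp
  moreover have "v div d * d \<le> v" by simp
  ultimately have "(v div d + t) * d < i * d"
    using key unfolding distrib_right by linarith
  then have "v div d + t < i" by simp
  then show False using t q ij by linarith
qed

lemma gaps_eq_staircase: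
  fixes e d :: nat
  assumes d: "0 < d" "d < e"
  shows "gaps (semigroup_generated ({e} \<union> {e + (e - d)..e + (e - 1)})) = staircase e d"
    (is "gaps ?S = _")
proof -
  have mem: "x \<in> ?S \<longleftrightarrow>
      (\<exists>i j. i \<le> j \<and> j * e + i * (e - d) \<le> x \<and> x \<le> j * e + i * (e - 1))" for x
    using d by (intro semigroup_generated_interval_iff) simp
  have "x \<notin> ?S" if st: "x \<in> staircase e d" for x
  proof
    assume "x \<in> ?S"
    then obtain i j where "i \<le> j" "j * e + i * (e - d) \<le> x" "x \<le> j * e + i * (e - 1)"
      unfolding mem by blast
    moreover obtain v q where "v < e - 1" "q \<le> 2 * (v div d)" "x = q * e + (e - 1 - v)"
      using st by (auto simp: staircase_def)
    ultimately show False using interval_misses_staircase d by blast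
  qed
  moreover have "x \<in> staircase e d" if gap: "x \<notin> ?S" for x
  proof -
    define q r where "q = x div e" and "r = x mod e"
    have x: "x = q * e + r" and r: "r < e" using d by (simp_all add: q_def r_def)
    have "r \<noteq> 0"
    proof
      assume "r = 0"
      then have "x \<in> ?S" unfolding mem x by (intro exI[of _ 0] exI[of _ q]) simp
      then show False using gap by blast
    qed
    define v where "v = e - 1 - r"
    have v: "v < e - 1" and rv: "r = e - 1 - v" "r + v + 1 = e"
      using \<open>r \<noteq> 0\<close> r by (auto simp: v_def)
    have "q \<le> 2 * (v div d)"
    proof (rule ccontr)
      assume large: "\<not> q \<le> 2 * (v div d)"
      \<comment> \<open>The intervals with \<open>i = v div d + 1\<close> and \<open>j + i = q + 1\<close> contain \<open>x\<close>; the
        bound on \<open>q\<close> is what makes \<open>i \<le> j\<close>.\<close>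
      define i j where "i = v div d + 1" and "j = q + 1 - i"
      have ij: "i \<le> j" "j + i = q + 1" using large by (auto simp: i_def j_def)
      have "v < i * d" using d by (simp add: i_def dividend_less_div_times)
      have "i \<le> v + 1" by (simp add: i_def)
      have "(j + i) * e = (q + 1) * e" using ij by simp
      then have je: "j * e + i * e = q * e + e" by (simp add: algebra_simps)
      have "i * (e - d) + i * d = i * e" "i * (e - 1) + i = i * e"
        using d by (simp_all add: diff_mult_distrib2)
      then have "j * e + i * (e - d) \<le> x \<and> x \<le> j * e + i * (e - 1)"
        using je x rv \<open>v < i * d\<close> \<open>i \<le> v + 1\<close> by linarith
      then show False using gap ij unfolding mem by blast
    qed
    then show ?thesis using v x rv by (force simp: staircase_def)
  qed
  ultimately show ?thesis by (auto simp: gaps_def)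
qed

text \<open>For fixed step \<open>c = v div d\<close> the largest entry has \<open>q = 2 c\<close> and \<open>v = c d\<close>; it
  equals \<open>e - 1 + c (2 e - d)\<close>, which grows with \<open>c\<close>.\<close>

lemma Max_staircase:
  fixes N d s :: nat
  assumes s: "1 \<le> s" "s \<le> d"
  defines "e \<equiv> N * d + s + 1"
  shows "Max (staircase e d) = 2 * N * e + s"
proof (rule Max_eqI)
  show "finite (staircase e d)" by (auto simp: staircase_def)
  have "N * d < e - 1" "2 * N \<le> 2 * (N * d div d)" "e - 1 - N * d = s"
    using s by (auto simp: e_def)
  then show "2 * N * e + s \<in> staircase e d"
    by (force simp: staircase_def image_iff)
next
  fix y assume "y \<in> staircase e d"
  then obtain v q where v: "v < e - 1" and q: "q \<le> 2 * (v div d)"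
    and y: "y = q * e + (e - 1 - v)"
    by (auto simp: staircase_def)
  define c where "c = v div d"
  have "c < N + 1"
    unfolding c_def using v s by (intro less_mult_imp_div_less) (simp add: e_def)
  then obtain t where t: "N = c + t" by (metis less_Suc_eq_le Suc_eq_plus1 le_Suc_ex)
  have cd: "c * d \<le> v" by (simp add: c_def)
  have "q * e \<le> 2 * c * e" using q by (simp add: c_def)
  moreover have "t * d \<le> 2 * t * e"
  proof (cases t)
    case (Suc t')
    then have "d \<le> e" using t by (auto simp: e_def)
    then show ?thesis by (intro mult_mono) auto
  qed simp
  ultimately show "y \<le> 2 * N * e + s"
    using y v cd t by (simp add: algebra_simps e_def)
qed

lemma sum_odd_steps:
  fixes N d s :: nat
  assumes "s \<le> d" "0 < d"
  shows "(\<Sum>v<N * d + s. 2 * (v div d) + 1) = N\<^sup>2 * d + (2 * N + 1) * s"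
  using \<open>s \<le> d\<close>
proof (induction N arbitrary: s)
  case 0
  then show ?case
  proof (induction s)
    case (Suc s)
    then show ?case by simp
  qed simp
next
  case (Suc N)
  then show ?case
  proof (induction s)
    case 0
    have "(\<Sum>v<N * d + d. 2 * (v div d) + 1) = N\<^sup>2 * d + (2 * N + 1) * d"
      using "0.prems" by blast
    then show ?case by (simp add: algebra_simps power2_eq_square)
  next
    case (Suc s)
    have "(Suc N * d + s) div d = Suc N"
      using Suc.prems \<open>0 < d\<close> by (intro div_nat_eqI) (simp_all add: algebra_simps)
    then show ?case using Suc by simp
  qed
qed

lemma card_staircase:
  fixes N d s :: nat
  assumes s: "1 \<le> s" "s \<le> d"
  shows "card (staircase (N * d + s + 1) d) = N\<^sup>2 * d + (2 * N + 1) * s"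
proof -
  define e where "e = N * d + s + 1"
  have inj: "inj_on (\<lambda>(v, q). q * e + (e - 1 - v)) (SIGMA v:{..<e - 1}. {..2 * (v div d)})"
  proof (rule inj_onI, clarify)
    fix v q v' q' :: nat
    assume "v < e - 1" "v' < e - 1" and eq: "q * e + (e - 1 - v) = q' * e + (e - 1 - v')"
    then have r: "e - 1 - v < e" "e - 1 - v' < e" by auto
    have "q = q'" using arg_cong[OF eq, of "\<lambda>x. x div e"] r by simp
    moreover have "v = v'" using eq \<open>q = q'\<close> \<open>v < e - 1\<close> \<open>v' < e - 1\<close> by simp
    ultimately show "v = v' \<and> q = q'" by simp
  qed
  have "card (staircase e d) = (\<Sum>v<e - 1. 2 * (v div d) + 1)"
    unfolding staircase_def card_image[OF inj] by simp
  also have "e - 1 = N * d + s" by (simp add: e_def)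
  also have "(\<Sum>v<N * d + s. 2 * (v div d) + 1) = N\<^sup>2 * d + (2 * N + 1) * s"
    using s by (intro sum_odd_steps) auto
  finally show ?thesis by (simp add: e_def)
qed

section \<open>Frobenius number, genus and symmetry\<close>

text \<open>In the coordinates \<open>N\<close>, \<open>d\<close>, \<open>s\<close> the invariants are subtraction-free and
  \<open>2 G - (F + 1) = (2 N + 1) (s - 1)\<close>.\<close>

lemma semigroup_invariants:
  fixes N d s :: nat
  assumes N: "1 \<le> N" and s: "1 \<le> s" "s \<le> d"
  defines "e \<equiv> N * d + s + 1"
  defines "S \<equiv> semigroup_generated ({e} \<union> {e + (e - d)..e + (e - 1)})"
  shows "numerical_semigroup S"
    and "frobenius_number S = 2 * N * e + s"
    and "genus S = N\<^sup>2 * d + (2 * N + 1) * s"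
    and "symmetric_semigroup S \<longleftrightarrow> s = 1"
proof -
  have "1 * d \<le> N * d" using N by (intro mult_right_mono) auto
  then have d: "0 < d" "d < e" using s unfolding e_def by linarith+
  have gaps: "gaps S = staircase e d" unfolding S_def using d by (rule gaps_eq_staircase)
  show num: "numerical_semigroup S"
    unfolding numerical_semigroup_def gaps
    by (auto simp: S_def staircase_def semigroup_generated.zero semigroup_generated_add_closed)
  show F: "frobenius_number S = 2 * N * e + s"
    unfolding frobenius_number_def gaps e_def by (rule Max_staircase[OF s])
  show G: "genus S = N\<^sup>2 * d + (2 * N + 1) * s"
    unfolding genus_def gaps e_def by (rule card_staircase[OF s])
  have "genus S \<noteq> 0" using G s by simp
  then have "S \<noteq> UNIV" by (auto simp: genus_def gaps_def)
  then have "symmetric_semigroup S \<longleftrightarrow> 2 * genus S = frobenius_number S + 1"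
    by (rule symmetric_iff_genus[OF num])
  also have "\<dots> \<longleftrightarrow> (2 * N + 1) * s = (2 * N + 1) * 1"
    unfolding F G e_def by (auto simp: algebra_simps power2_eq_square)
  also have "\<dots> \<longleftrightarrow> s = 1" by (subst mult_cancel1) simp
  finally show "symmetric_semigroup S \<longleftrightarrow> s = 1" .
qed

theorem theorem4p8:
  fixes e k n :: nat and S :: "nat set"
  assumes "1 \<le> k" and "k + 3 \<le> e" and "2 \<le> n"
    and "(real n - 2) / (real n - 1) < real k / (real e - 1)"
    and "real k / (real e - 1) \<le> (real n - 1) / real n"
    and "S = semigroup_generated ({e} \<union> {e + k + 1..2 * e - 1})"
  shows "numerical_semigroup S \<and>
    int (frobenius_number S) = int n * int e + (int n - 1) * int k + (int n - 2) \<and>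
    int (genus S) = int n * (int n - 1) * int k - ((int n)^2 - 3 * int n + 1) * (int e - 1) \<and>
    (symmetric_semigroup S \<longleftrightarrow> (int n - 1) * int k = (int n - 2) * int e - (int n - 3))"
proof -
  \<comment> \<open>\<open>d\<close> is the number of generators other than \<open>e\<close>. The two fractional bounds become
    \<open>N d < e - 1 \<le> (N + 1) d\<close>.\<close>
  define N d where "N = n - 1" and "d = e - 1 - k"
  have N: "1 \<le> N" and n: "n = N + 1" using assms(3) by (auto simp: N_def)
  have e: "e = k + d + 1" using assms(2) by (simp add: d_def)
  have pos: "0 < real k + real d" "0 < real N" using assms(1) N by auto
  have "real N * real d < real k + real d"
    using assms(4) pos unfolding n e by (simp add: field_simps)
  then have lt: "N * d < k + d" by (simp flip: of_nat_mult of_nat_add)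
  have "real k + real d \<le> (real N + 1) * real d"
    using assms(5) pos unfolding n e by (simp add: field_simps)
  then have "real (k + d) \<le> real ((N + 1) * d)" by (simp only: of_nat_add of_nat_mult of_nat_1)
  then have le: "k + d \<le> (N + 1) * d" by (simp only: of_nat_le_iff)
  define s where "s = k + d - N * d"
  have s: "1 \<le> s" "s \<le> d" and kd: "k + d = N * d + s"
    using lt le by (auto simp: s_def)
  have e': "e = N * d + s + 1" using e kd by simp
  have ends: "e + k + 1 = e + (e - d)" "2 * e - 1 = e + (e - 1)" using e by auto
  have S: "S = semigroup_generated ({e} \<union> {e + (e - d)..e + (e - 1)})"
    using assms(6) unfolding ends .
  note inv = semigroup_invariants[OF N s, folded e', folded S]
  have k: "int k = int N * int d + int s - int d"
    using kd by (metis add_diff_cancel_right' of_nat_add of_nat_mult)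
  have e'': "int e = int N * int d + int s + 1" using e' by simp
  have n': "int n = int N + 1" using n by simp
  have "int (frobenius_number S) = int n * int e + (int n - 1) * int k + (int n - 2)"
    unfolding inv(2) of_nat_add of_nat_mult k e'' n' by (simp add: algebra_simps)
  moreover have "int (genus S) =
      int n * (int n - 1) * int k - ((int n)^2 - 3 * int n + 1) * (int e - 1)"
    unfolding inv(3) of_nat_add of_nat_mult of_nat_power k e'' n'
    by (simp add: algebra_simps power2_eq_square)
  moreover have "(int n - 1) * int k = (int n - 2) * int e - (int n - 3) \<longleftrightarrow> s = 1"
    unfolding k e'' n' by (simp add: algebra_simps)
  ultimately show ?thesis using inv(1,4) by simp
qed

end
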